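(* Let $H:\mathcal{T}\to\mathbb{R}$ be given, where $\mathcal{T}=\{(a,b)\in\mathbb{R}^2: 0\le a<b\le 1\}$. Then the following are equivalent: 1. There exists some $f:[0,1]\to\mathbb{R}$ such that $\mathrm{DQ}_f(a,b)=H(a,b)$ for all $(a,b)\in\mathcal{T}$. 2. For all $0\le a<b<c\le 1$, $$H(a,c)=\frac{H(a,b)(b-a)+H(b,c)(c-b)}{c-a}.$$ 3. For all $0<b<c\le 1$, $$H(0,c)=\frac{H(0,b)\,b+H(b,c)(c-b)}{c}.$$
   Context: For a function $f:[0,1]\to\mathbb{R}$, the difference quotient of $f$ is the function $\mathrm{DQ}_f$ on $\mathcal{T}$ given by $\mathrm{DQ}_f(a,b)=\dfrac{f(b)-f(a)}{b-a}$. All variables and functions are real-valued. *)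

theory Defs
  imports Complex_Main
begin

definition T :: "(real \<times> real) set" where
  "T = {(a, b). 0 \<le> a \<and> a < b \<and> b \<le> 1}"

text \<open>
  Functions on \<open>[0,1]\<close> are represented by total functions on the reals. On \<open>T\<close> the
  difference quotient depends only on the values of \<open>f\<close> in \<open>[0,1]\<close>.
\<close>

definition DQ :: "(real \<Rightarrow> real) \<Rightarrow> real \<times> real \<Rightarrow> real" where
  "DQ f = (\<lambda>(a, b). (f b - f a) / (b - a))"

end

theory Submission
  imports Defs
begin

text \<open>
  Multiplied by its denominator, the condition on triples says that the interval function
  \<open>H (a, b) * (b - a)\<close> is additive on adjacent intervals. Increments \<open>f b - f a\<close> are additive
  because they telescope (\<open>DQ_split\<close>). Conversely, an additive interval function is the increment
  of its own primitive from a base point, here \<open>x \<mapsto> x * H (0, x)\<close>. Recovering the increments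
  of this primitive uses additivity only for splittings of intervals that start at the
  base point \<open>0\<close> (\<open>DQ_primitive_from_zero\<close>), which is why the triples with \<open>a = 0\<close> already imply
  all the others.
\<close>

lemma DQ_split:
  assumes "a < b" "b < c"
  shows "DQ f (a, c) = (DQ f (a, b) * (b - a) + DQ f (b, c) * (c - b)) / (c - a)"
  using assms by (simp add: DQ_def)

text \<open>
  For \<open>a > 0\<close> the hypothesis, applied to the splitting of \<open>[0, b]\<close> at \<open>a\<close>, gives
  \<open>b * H (0, b) - a * H (0, a) = H (a, b) * (b - a)\<close>. For \<open>a = 0\<close> no splitting is available, but the
  factor \<open>x\<close> makes the primitive vanish at \<open>0\<close> whatever the value \<open>H (0, 0)\<close> outside the
  domain is.
\<close>

lemma DQ_primitive_from_zero:
  fixes H :: "real \<times> real \<Rightarrow> real"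
  assumes split: "\<And>b c. 0 < b \<Longrightarrow> b < c \<Longrightarrow> c \<le> 1 \<Longrightarrow>
      H (0, c) = (H (0, b) * b + H (b, c) * (c - b)) / c"
    and "(a, b) \<in> T"
  shows "DQ (\<lambda>x. x * H (0, x)) (a, b) = H (a, b)"
proof -
  from \<open>(a, b) \<in> T\<close> have ab: "0 \<le> a" "a < b" "b \<le> 1"
    by (auto simp: T_def)
  show ?thesis
  proof (cases "a = 0")
    case True
    with ab show ?thesis by (simp add: DQ_def)
  next
    case False
    with ab have "H (0, b) = (H (0, a) * a + H (a, b) * (b - a)) / b"
      by (intro split) auto
    with ab have "b * H (0, b) - a * H (0, a) = H (a, b) * (b - a)"
      by (simp add: field_simps)
    with ab show ?thesis by (simp add: DQ_def)
  qed
qed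

theorem theorem1:
  fixes H :: "real \<times> real \<Rightarrow> real"
  shows
    "((\<exists>f :: real \<Rightarrow> real. \<forall>(a, b) \<in> T. DQ f (a, b) = H (a, b)) \<longleftrightarrow>
      (\<forall>a b c. 0 \<le> a \<and> a < b \<and> b < c \<and> c \<le> 1 \<longrightarrow>
         H (a, c) = (H (a, b) * (b - a) + H (b, c) * (c - b)) / (c - a)))
     \<and>
     ((\<forall>a b c. 0 \<le> a \<and> a < b \<and> b < c \<and> c \<le> 1 \<longrightarrow>
         H (a, c) = (H (a, b) * (b - a) + H (b, c) * (c - b)) / (c - a)) \<longleftrightarrow>
      (\<forall>b c. 0 < b \<and> b < c \<and> c \<le> 1 \<longrightarrow>
         H (0, c) = (H (0, b) * b + H (b, c) * (c - b)) / c))"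
    (is "(?quotient \<longleftrightarrow> ?additive) \<and> (?additive \<longleftrightarrow> ?additive_at_zero)")
proof -
  have "?additive" if quotient: "?quotient"
  proof (intro allI impI)
    fix a b c :: real
    assume abc: "0 \<le> a \<and> a < b \<and> b < c \<and> c \<le> 1"
    from quotient obtain f where f: "\<And>x y. (x, y) \<in> T \<Longrightarrow> DQ f (x, y) = H (x, y)"
      by blast
    from abc have "(a, b) \<in> T" "(b, c) \<in> T" "(a, c) \<in> T"
      by (auto simp: T_def)
    with DQ_split[of a b c f] abc
    show "H (a, c) = (H (a, b) * (b - a) + H (b, c) * (c - b)) / (c - a)"
      by (simp add: f)
  qed
  moreover have "?additive_at_zero" if additive: "?additive"
  proof (intro allI impI)
    fix b c :: real
    assume "0 < b \<and> b < c \<and> c \<le> 1"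
    with additive[rule_format, of 0 b c]
    show "H (0, c) = (H (0, b) * b + H (b, c) * (c - b)) / c"
      by simp
  qed
  moreover have "?quotient" if at_zero: "?additive_at_zero"
  proof -
    have "\<forall>(a, b) \<in> T. DQ (\<lambda>x. x * H (0, x)) (a, b) = H (a, b)"
      using DQ_primitive_from_zero[of H] at_zero by blast
    then show ?thesis by blast
  qed
  ultimately show ?thesis by argo
qed

end
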